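(* Let $n,p\ge 1$ and $1\le s\le p$ be integers, $\delta\ge 0$, $\varepsilon\ge0$, let $\Theta\subseteq\mathbb{R}^p$ be a convex set, let $\theta_s\in\Theta$ be $s$-sparse, and let $$y=X\theta_s+\xi,\qquad Z=X+\Xi,$$ where $X,\Xi$ are $n\times p$ real matrices and $\xi\in\mathbb{R}^n$. Assume that all the diagonal elements of $X^TX/n$ are equal to $1$, and that $$\Big|\frac1n Z^T\xi\Big|_\infty\le\varepsilon,\qquad |\Xi|_\infty\le\delta.$$ Set $\nu=2(2+\delta)\delta|\theta_s|_1+2\varepsilon$. Let $\hat\theta$ be any solution of $$\min\Big\{|\theta|_1:\ \theta\in\Theta,\ \Big|\frac1nZ^T(y-Z\theta)\Big|_\infty\le(1+\delta)\delta|\theta|_1+\varepsilon\Big\}.$$ Then the following hold. (i) If Assumption RE($s$) holds with constant $\kappa>0$, then $$|\hat\theta-\theta_s|_1\le\frac{4\nu s}{\kappa^2},\qquad \frac1n|X(\hat\theta-\theta_s)|_2^2\le\frac{4\nu^2s}{\kappa^2}.$$ (ii) If Assumption RE($2s$) holds with constant $\kappa>0$, then $$|\hat\theta-\theta_s|_q^q\le\Big(\frac{4\nu}{\kappa^2}\Big)^q s\qquad\text{for all }1<q\le2.$$ (iii) If Assumption C holds with $\rho<\frac1{3\alpha s}$ for some $\alpha>1$, then $$|\hat\theta-\theta_s|_\infty<\frac{3\alpha+1}{3(\alpha-1)}\,\nu.$$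
   Context: For a vector $x$, $|x|_q$ ($q\ge1$) is its $\ell_q$-norm and $|x|_\infty$ the maximum absolute value of its components; for a matrix, $|\cdot|_\infty$ is the maximum absolute value of its entries. A vector is $s$-sparse if it has at most $s$ nonzero components. For $\theta\in\mathbb{R}^p$ and $J\subseteq\{1,\dots,p\}$, $\theta_J\in\mathbb{R}^p$ has the same coordinates as $\theta$ on $J$ and zero coordinates on the complement $J^c$. Assumption RE($s$) (on $X$) with constant $\kappa>0$: for all $J\subseteq\{1,\dots,p\}$ with $|J|\le s$ and all $\Delta\in\mathbb{R}^p$, $\Delta\neq0$, with $|\Delta_{J^c}|_1\le|\Delta_J|_1$, one has $\frac{|X\Delta|_2}{\sqrt n\,|\Delta_J|_2}\ge\kappa$ (if $\Delta_J=0$ there is no such $\Delta$). RE($2s$) is the same with $|J|\le 2s$. Assumption C (on $X$) with parameter $\rho<1$: all diagonal elements of $\Psi=X^TX/n$ equal $1$, and the off-diagonal elements satisfy $\max_{i\ne j}|\Psi_{ij}|\le\rho$.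
   Formalization: In (iii) the strict inequality is asserted only when ν > 0; when ν = 0 the printed claim is false (it would read |θ̂ − θ_s|_∞ < 0), and the non-strict bound, i.e. θ̂ = θ_s, is asserted instead. *)

theory Defs
  imports "HOL-Analysis.Analysis"
begin

text \<open>
  The dimensions are the index types: \<open>n = CARD('n)\<close>, \<open>p = CARD('p)\<close>, both at least 1,
  and an \<open>n \<times> p\<close> matrix has type \<open>real ^ 'p ^ 'n\<close>.  The library's \<open>infnorm\<close> serves as
  \<open>|.|\<^sub>\<infinity>\<close> for vectors and for matrices (\<open>infnorm_vec\<close>, \<open>infnorm_mat\<close> below), and
  \<open>norm\<close> is the Euclidean norm (\<open>lq_norm_2\<close>).
\<close>

definition lq_norm :: "real \<Rightarrow> real ^ 'p \<Rightarrow> real" where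
  "lq_norm q x = (\<Sum>i\<in>UNIV. \<bar>x $ i\<bar> powr q) powr (1 / q)"

definition s_sparse :: "nat \<Rightarrow> real ^ 'p \<Rightarrow> bool" where
  "s_sparse s x \<longleftrightarrow> card {i. x $ i \<noteq> 0} \<le> s"

definition restr :: "'p set \<Rightarrow> real ^ 'p \<Rightarrow> real ^ 'p" where
  "restr J x = (\<chi> i. if i \<in> J then x $ i else 0)"

definition gram :: "real ^ 'p ^ 'n \<Rightarrow> real ^ 'p ^ 'p" where
  "gram X = (1 / real CARD('n)) *\<^sub>R (transpose X ** X)"

text \<open>
  The quotient in the next definition never has denominator 0 (which would make it 0 in HOL):
  \<open>restr_zero_imp_zero\<close> below.
\<close>

definition RE :: "real ^ 'p ^ 'n \<Rightarrow> nat \<Rightarrow> real \<Rightarrow> bool" where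
  "RE X s \<kappa> \<longleftrightarrow> \<kappa> > 0 \<and>
     (\<forall>J \<Delta>. card J \<le> s \<and> \<Delta> \<noteq> 0 \<and> lq_norm 1 (restr (- J) \<Delta>) \<le> lq_norm 1 (restr J \<Delta>)
        \<longrightarrow> norm (X *v \<Delta>) / (sqrt (real CARD('n)) * norm (restr J \<Delta>)) \<ge> \<kappa>)"

definition coherence :: "real ^ 'p ^ 'n \<Rightarrow> real \<Rightarrow> bool" where
  "coherence X \<rho> \<longleftrightarrow> \<rho> < 1 \<and> (\<forall>i. gram X $ i $ i = 1) \<and>
     (\<forall>i j. i \<noteq> j \<longrightarrow> \<bar>gram X $ i $ j\<bar> \<le> \<rho>)"

definition feasible ::
    "(real ^ 'p) set \<Rightarrow> real ^ 'p ^ 'n \<Rightarrow> real ^ 'n \<Rightarrow> real \<Rightarrow> real \<Rightarrow> real ^ 'p \<Rightarrow> bool" where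
  "feasible \<Theta> Z y \<delta> \<epsilon> \<theta> \<longleftrightarrow> \<theta> \<in> \<Theta> \<and>
     infnorm ((1 / real CARD('n)) *\<^sub>R (transpose Z *v (y - Z *v \<theta>)))
       \<le> (1 + \<delta>) * \<delta> * lq_norm 1 \<theta> + \<epsilon>"

lemma lq_norm_1: "lq_norm 1 x = (\<Sum>i\<in>UNIV. \<bar>x $ i\<bar>)"
  by (simp add: lq_norm_def sum_nonneg)

lemma lq_norm_2: "lq_norm 2 x = norm x"
  by (simp add: lq_norm_def norm_vec_def L2_set_def powr_half_sqrt sum_nonneg)

lemma infnorm_vec: "infnorm (x :: real ^ 'p) = (MAX i. \<bar>x $ i\<bar>)"
proof -
  have "(\<lambda>b. \<bar>x \<bullet> b\<bar>) ` Basis = range (\<lambda>i. \<bar>x $ i\<bar>)"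
    by (force simp: Basis_vec_def inner_axis image_iff)
  then show ?thesis
    by (simp add: infnorm_Max)
qed

lemma infnorm_mat: "infnorm (A :: real ^ 'p ^ 'n) = (MAX (i, j). \<bar>A $ i $ j\<bar>)"
proof -
  have "(\<lambda>b. \<bar>A \<bullet> b\<bar>) ` Basis = range (\<lambda>(i, j). \<bar>A $ i $ j\<bar>)"
    by (force simp: Basis_vec_def inner_axis image_iff)
  then show ?thesis
    by (simp add: infnorm_Max)
qed

lemma restr_zero_imp_zero:
  assumes "lq_norm 1 (restr (- J) x) \<le> lq_norm 1 (restr J x)" and "restr J x = 0"
  shows "x = 0"
proof -
  have "(\<Sum>i\<in>UNIV. \<bar>restr (- J) x $ i\<bar>) = 0"
    using assms by (intro antisym) (auto simp: lq_norm_1 sum_nonneg)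
  then have "restr (- J) x $ i = 0" for i
    by (simp add: sum_nonneg_eq_0_iff)
  with assms(2) show ?thesis
    by (simp add: restr_def vec_eq_iff) metis
qed

end

theory Submission
  imports Defs
begin

text \<open>
  The true parameter \<open>\<theta>\<^sub>s\<close> is itself feasible, so \<open>|\<theta>hat|\<^sub>1 \<le> |\<theta>\<^sub>s|\<^sub>1\<close> by minimality, and the error
  \<open>v = \<theta>hat - \<theta>\<^sub>s\<close> lies in the cone \<open>|v\<^bsub>-J\<^esub>|\<^sub>1 \<le> |v\<^sub>J|\<^sub>1\<close> for \<open>J\<close> the support of \<open>\<theta>\<^sub>s\<close>.
  Comparing the two feasibility constraints gives \<open>|\<Psi> v|\<^sub>\<infinity> \<le> \<nu>\<close> for the Gram matrix \<open>\<Psi>\<close>.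
  Pairing this with \<open>v\<close> bounds \<open>|Xv|\<^sup>2 / n\<close> by \<open>\<nu> |v|\<^sub>1\<close>, which the restricted eigenvalue
  condition turns into \<open>\<ell>\<^sub>1\<close>- and \<open>\<ell>\<^sub>2\<close>-bounds; interpolation covers \<open>1 < q < 2\<close>.
  Under coherence, \<open>\<Psi>\<close> is close to the identity entrywise, so \<open>|v|\<^sub>\<infinity> \<le> \<nu> + \<rho> |v|\<^sub>1\<close> with
  \<open>|v|\<^sub>1 \<le> 2 s |v|\<^sub>\<infinity>\<close>.
\<close>

section \<open>Norms and coordinate restriction\<close>

lemma infnorm_vec_le_iff: "infnorm (x :: real ^ 'p) \<le> b \<longleftrightarrow> (\<forall>i. \<bar>x $ i\<bar> \<le> b)"
  by (simp add: infnorm_vec)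

lemma infnorm_mat_le_iff:
  "infnorm (A :: real ^ 'p ^ 'n) \<le> b \<longleftrightarrow> (\<forall>i j. \<bar>A $ i $ j\<bar> \<le> b)"
  by (simp add: infnorm_mat)

lemma lq_norm_1_restr: "lq_norm 1 (restr J x) = (\<Sum>i\<in>J. \<bar>x $ i\<bar>)"
proof -
  have "lq_norm 1 (restr J x) = (\<Sum>i\<in>UNIV. if i \<in> J then \<bar>x $ i\<bar> else 0)"
    unfolding lq_norm_1 by (intro sum.cong) (auto simp: restr_def)
  then show ?thesis
    by (simp add: sum.If_cases)
qed

lemma norm_vec_power2: "(norm (x :: real ^ 'p))\<^sup>2 = (\<Sum>i\<in>UNIV. (x $ i)\<^sup>2)"
  by (simp add: norm_vec_def L2_set_def sum_nonneg)

lemma norm_restr_power2: "(norm (restr J x))\<^sup>2 = (\<Sum>i\<in>J. (x $ i)\<^sup>2)"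
proof -
  have "(norm (restr J x))\<^sup>2 = (\<Sum>i\<in>UNIV. if i \<in> J then (x $ i)\<^sup>2 else 0)"
    unfolding norm_vec_power2 by (intro sum.cong) (auto simp: restr_def)
  then show ?thesis
    by (simp add: sum.If_cases)
qed

lemma sum_UNIV_split:
  fixes f :: "'a::finite \<Rightarrow> 'b::comm_monoid_add"
  shows "sum f UNIV = sum f J + sum f (- J)"
  by (metis Compl_eq_Diff_UNIV add.commute finite subset_UNIV sum.subset_diff)

lemma lq_norm_1_split:
  "lq_norm 1 x = lq_norm 1 (restr J x) + lq_norm 1 (restr (- J) x)"
  unfolding lq_norm_1_restr by (simp add: lq_norm_1 sum_UNIV_split[where J = J])

lemma lq_norm_1_nonneg: "0 \<le> lq_norm 1 x"
  by (simp add: lq_norm_1 sum_nonneg)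

lemma lq_norm_1_triangle_diff: "lq_norm 1 (x - y) \<le> lq_norm 1 x + lq_norm 1 y"
  unfolding lq_norm_1 sum.distrib[symmetric] by (intro sum_mono) (simp add: abs_triangle_ineq4)

text \<open>Cauchy-Schwarz on \<open>J\<close> against the constant vector 1, whose Euclidean length
  there is at most \<open>sqrt s\<close>.\<close>

lemma lq_norm_1_restr_le:
  assumes "card J \<le> s"
  shows "lq_norm 1 (restr J x) \<le> sqrt (real s) * norm (restr J x)"
proof -
  have "lq_norm 1 (restr J x) \<le> L2_set (\<lambda>_. 1) J * L2_set (\<lambda>i. x $ i) J"
    using L2_set_mult_ineq[of "\<lambda>_. 1" "\<lambda>i. x $ i" J] by (simp add: lq_norm_1_restr)
  also have "\<dots> = sqrt (real (card J)) * norm (restr J x)"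
    using norm_restr_power2[of J x] by (simp add: L2_set_def real_sqrt_unique)
  also have "\<dots> \<le> sqrt (real s) * norm (restr J x)"
    using assms by (intro mult_right_mono) auto
  finally show ?thesis .
qed

lemma norm_restr_mono:
  assumes "J \<subseteq> K"
  shows "norm (restr J x) \<le> norm (restr K x)"
proof -
  have "(norm (restr J x))\<^sup>2 \<le> (norm (restr K x))\<^sup>2"
    unfolding norm_restr_power2 using assms by (intro sum_mono2) auto
  then show ?thesis
    by (rule power2_le_imp_le) simp
qed

lemma norm_le_sqrt_card_times_bound:
  fixes v :: "real ^ 'n"
  assumes "\<And>i. \<bar>v $ i\<bar> \<le> d"
  shows "norm v \<le> sqrt (real CARD('n)) * d"
proof -
  have d: "0 \<le> d"
    using assms[of undefined] by linarith
  have "(\<Sum>i\<in>UNIV. (v $ i)\<^sup>2) \<le> (\<Sum>i\<in>(UNIV :: 'n set). d\<^sup>2)"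
    using assms d by (intro sum_mono) (simp add: abs_le_square_iff[symmetric])
  then have "norm v \<le> sqrt (real CARD('n) * d\<^sup>2)"
    by (simp add: norm_vec_def L2_set_def)
  then show ?thesis
    using d by (simp add: real_sqrt_mult)
qed

section \<open>Gram matrix, columns and energy\<close>

lemma gram_component:
  fixes X :: "real ^ 'p ^ 'n"
  shows "gram X $ i $ j = 1 / real CARD('n) * (column i X \<bullet> column j X)"
  by (simp add: gram_def matrix_matrix_mult_def transpose_def column_def inner_vec_def)

lemma gram_mult:
  fixes X :: "real ^ 'p ^ 'n"
  shows "gram X *v v = (1 / real CARD('n)) *\<^sub>R (transpose X *v (X *v v))"
  by (simp add: gram_def matrix_vector_mul_assoc scaleR_matrix_vector_assoc)

lemma norm_column_eq:
  fixes X :: "real ^ 'p ^ 'n"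
  assumes "gram X $ i $ i = 1"
  shows "norm (column i X) = sqrt (real CARD('n))"
  using assms by (simp add: gram_component norm_eq_sqrt_inner field_simps)

lemma norm_mult_vec_le:
  fixes A :: "real ^ 'p ^ 'n"
  assumes "\<And>i. norm (column i A) \<le> b"
  shows "norm (A *v x) \<le> b * lq_norm 1 x"
proof -
  have "norm (A *v x) \<le> (\<Sum>i\<in>UNIV. norm (x $ i *s column i A))"
    unfolding matrix_mult_sum by (rule norm_sum)
  also have "\<dots> \<le> (\<Sum>i\<in>UNIV. \<bar>x $ i\<bar> * b)"
    using assms by (intro sum_mono) (simp add: scalar_mult_eq_scaleR mult_left_mono)
  finally show ?thesis
    by (simp add: lq_norm_1 sum_distrib_left mult.commute)
qed

text \<open>Coordinate \<open>i\<close> of the transposed product is an inner product with column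
  \<open>i\<close>; in Cauchy-Schwarz the two factors \<open>sqrt n\<close> cancel the prefactor
  \<open>1/n\<close>.\<close>

lemma abs_transpose_mult_component_le:
  fixes A :: "real ^ 'p ^ 'n"
  assumes "norm (column i A) \<le> sqrt (real CARD('n)) * a"
    and "norm v \<le> sqrt (real CARD('n)) * b"
  shows "\<bar>((1 / real CARD('n)) *\<^sub>R (transpose A *v v)) $ i\<bar> \<le> a * b"
proof -
  have "\<bar>column i A \<bullet> v\<bar> \<le> norm (column i A) * norm v"
    by (rule Cauchy_Schwarz_ineq2)
  also have "\<dots> \<le> (sqrt (real CARD('n)) * a) * (sqrt (real CARD('n)) * b)"
    using assms by (intro mult_mono) (auto intro: order_trans[OF norm_ge_zero])
  also have "\<dots> = real CARD('n) * (a * b)"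
    by (simp add: algebra_simps)
  finally have "\<bar>column i A \<bullet> v\<bar> \<le> real CARD('n) * (a * b)" .
  moreover have "(transpose A *v v) $ i = column i A \<bullet> v"
    by (simp add: matrix_vector_mul_component transpose_def column_def)
  ultimately show ?thesis
    by (simp add: abs_mult field_simps)
qed

text \<open>The left side is the quadratic form of \<open>gram X\<close> at \<open>v\<close>,
  bounded by the duality of the l1 and sup norms.\<close>

lemma energy_le:
  fixes X :: "real ^ 'p ^ 'n"
  assumes "\<And>i. \<bar>(gram X *v v) $ i\<bar> \<le> \<nu>"
  shows "(norm (X *v v) / sqrt (real CARD('n)))\<^sup>2 \<le> \<nu> * lq_norm 1 v"
proof -
  have "(norm (X *v v))\<^sup>2 = v \<bullet> (transpose X *v (X *v v))"
    by (metis dot_lmul_matrix power2_norm_eq_inner transpose_matrix_vector inner_commute)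
  then have "(norm (X *v v) / sqrt (real CARD('n)))\<^sup>2 = v \<bullet> (gram X *v v)"
    by (simp add: gram_mult power_divide)
  also have "\<dots> \<le> (\<Sum>i\<in>UNIV. \<bar>v $ i\<bar> * \<nu>)"
    unfolding inner_vec_def
  proof (intro sum_mono)
    fix i
    have "v $ i \<bullet> (gram X *v v) $ i \<le> \<bar>v $ i\<bar> * \<bar>(gram X *v v) $ i\<bar>"
      by (simp add: abs_mult[symmetric])
    also have "\<dots> \<le> \<bar>v $ i\<bar> * \<nu>"
      using assms by (intro mult_left_mono) auto
    finally show "v $ i \<bullet> (gram X *v v) $ i \<le> \<bar>v $ i\<bar> * \<nu>" .
  qed
  finally show ?thesis
    by (simp add: lq_norm_1 sum_distrib_left mult.commute)
qed

section \<open>Cone condition and restricted eigenvalues\<close>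

text \<open>Off \<open>J\<close> the difference is just \<open>\<theta>\<close>; as
  \<open>\<theta>\<close> is no longer than \<open>\<theta>'\<close> in l1, this mass must be offset
  by what \<open>\<theta>\<close> loses on \<open>J\<close>.\<close>

lemma cone_of_lq_norm_1_le:
  assumes "lq_norm 1 \<theta> \<le> lq_norm 1 \<theta>'" and "\<And>i. i \<notin> J \<Longrightarrow> \<theta>' $ i = 0"
  shows "lq_norm 1 (restr (- J) (\<theta> - \<theta>')) \<le> lq_norm 1 (restr J (\<theta> - \<theta>'))"
proof -
  have "lq_norm 1 (restr (- J) \<theta>') = 0"
    using assms(2) by (simp add: lq_norm_1_restr)
  moreover have "lq_norm 1 (restr (- J) (\<theta> - \<theta>')) = lq_norm 1 (restr (- J) \<theta>)"
    using assms(2) by (simp add: lq_norm_1_restr)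
  moreover have "lq_norm 1 (restr J \<theta>') \<le> lq_norm 1 (restr J \<theta>) + lq_norm 1 (restr J (\<theta> - \<theta>'))"
    unfolding lq_norm_1_restr sum.distrib[symmetric] by (intro sum_mono) auto
  ultimately show ?thesis
    using assms(1) lq_norm_1_split[of \<theta> J] lq_norm_1_split[of \<theta>' J] by linarith
qed

text \<open>Form of the restricted eigenvalue condition without a quotient, which also covers
  \<open>v = 0\<close>.\<close>

lemma RE_D:
  fixes X :: "real ^ 'p ^ 'n"
  assumes "RE X m \<kappa>" and "card K \<le> m"
    and cone: "lq_norm 1 (restr (- K) v) \<le> lq_norm 1 (restr K v)"
  shows "\<kappa> * norm (restr K v) \<le> norm (X *v v) / sqrt (real CARD('n))"
proof (cases "v = 0")
  case True
  then have "restr K v = 0"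
    by (simp add: restr_def vec_eq_iff)
  then show ?thesis
    by simp
next
  case False
  then have "0 < norm (restr K v)"
    using restr_zero_imp_zero[OF cone] by auto
  moreover have "\<kappa> \<le> norm (X *v v) / (sqrt (real CARD('n)) * norm (restr K v))"
    using assms False by (simp add: RE_def)
  ultimately show ?thesis
    by (simp add: field_simps)
qed

text \<open>With \<open>E = |Xv| / sqrt n\<close>, the energy bound and the cone give
  \<open>E^2 \<le> \<nu> |v|_1 \<le> 2 \<nu> sqrt s E / \<kappa>\<close>, and one factor
  \<open>E\<close> cancels. The factor \<open>sqrt s\<close> comes from \<open>J\<close>, while the
  eigenvalue condition is applied on \<open>K\<close>: \<open>K = J\<close> serves the l1 and
  prediction bounds, a larger \<open>K\<close> the l2 bound.\<close>

lemma RE_error_bounds: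
  fixes X :: "real ^ 'p ^ 'n"
  assumes RE: "RE X m \<kappa>" and JK: "J \<subseteq> K" and J: "card J \<le> s" and K: "card K \<le> m"
    and cone: "lq_norm 1 (restr (- J) v) \<le> lq_norm 1 (restr J v)"
    and gram: "\<And>i. \<bar>(gram X *v v) $ i\<bar> \<le> \<nu>"
  shows "norm (X *v v) / sqrt (real CARD('n)) \<le> 2 * \<nu> * sqrt (real s) / \<kappa>"
    and "norm (restr K v) \<le> 2 * \<nu> * sqrt (real s) / \<kappa>\<^sup>2"
proof -
  define E where "E = norm (X *v v) / sqrt (real CARD('n))"
  have \<kappa>: "0 < \<kappa>"
    using RE by (simp add: RE_def)
  have \<nu>: "0 \<le> \<nu>"
    using gram[of undefined] by linarith
  have E: "0 \<le> E"
    by (simp add: E_def)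
  \<comment> \<open>Enlarging \<open>J\<close> to \<open>K\<close> moves l1 mass from the left to
    the right side of the cone inequality, so the cone condition persists.\<close>
  have "lq_norm 1 (restr J v) \<le> lq_norm 1 (restr K v)"
    unfolding lq_norm_1_restr using JK by (intro sum_mono2) auto
  then have "lq_norm 1 (restr (- K) v) \<le> lq_norm 1 (restr K v)"
    using cone lq_norm_1_split[of v J] lq_norm_1_split[of v K] by linarith
  then have KE: "\<kappa> * norm (restr K v) \<le> E"
    unfolding E_def by (rule RE_D[OF RE K])
  have "lq_norm 1 v \<le> 2 * (sqrt (real s) * norm (restr J v))"
    using cone lq_norm_1_split[of v J] lq_norm_1_restr_le[OF J, of v] by linarith
  also have "\<dots> \<le> 2 * (sqrt (real s) * norm (restr K v))"
    using norm_restr_mono[OF JK, of v] by (simp add: mult_left_mono)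
  also have "\<dots> \<le> 2 * (sqrt (real s) * (E / \<kappa>))"
    using KE \<kappa> by (intro mult_left_mono) (auto simp: field_simps)
  finally have "\<nu> * lq_norm 1 v \<le> \<nu> * (2 * (sqrt (real s) * (E / \<kappa>)))"
    using \<nu> by (rule mult_left_mono)
  then have "E * E \<le> (2 * \<nu> * sqrt (real s) / \<kappa>) * E"
    using energy_le[of X v, OF gram] by (simp add: E_def[symmetric] power2_eq_square mult_ac)
  then have E_le: "E \<le> 2 * \<nu> * sqrt (real s) / \<kappa>"
    using E \<nu> \<kappa> by (cases "E = 0") (auto dest: mult_right_le_imp_le simp del: times_divide_eq_left)
  then show "norm (X *v v) / sqrt (real CARD('n)) \<le> 2 * \<nu> * sqrt (real s) / \<kappa>"
    by (simp add: E_def)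
  have "\<kappa> * norm (restr K v) \<le> 2 * \<nu> * sqrt (real s) / \<kappa>"
    using KE E_le by linarith
  then show "norm (restr K v) \<le> 2 * \<nu> * sqrt (real s) / \<kappa>\<^sup>2"
    using \<kappa> by (simp add: field_simps power2_eq_square)
qed

text \<open>The case \<open>K = J\<close>; allowing \<open>s \<le> m\<close> makes the bound
  available under RE(2s) as well.\<close>

lemma RE_lq_norm_1_bound:
  fixes X :: "real ^ 'p ^ 'n"
  assumes "RE X m \<kappa>" and "s \<le> m" and J: "card J \<le> s"
    and cone: "lq_norm 1 (restr (- J) v) \<le> lq_norm 1 (restr J v)"
    and "\<And>i. \<bar>(gram X *v v) $ i\<bar> \<le> \<nu>"
  shows "lq_norm 1 v \<le> 4 * \<nu> * real s / \<kappa>\<^sup>2"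
proof -
  have "lq_norm 1 v \<le> 2 * (sqrt (real s) * norm (restr J v))"
    using cone lq_norm_1_split[of v J] lq_norm_1_restr_le[OF J, of v] by linarith
  also have "\<dots> \<le> 2 * (sqrt (real s) * (2 * \<nu> * sqrt (real s) / \<kappa>\<^sup>2))"
    using assms by (intro mult_left_mono RE_error_bounds(2)[of X m \<kappa> J J s v]) auto
  also have "\<dots> = 4 * \<nu> * (sqrt (real s) * sqrt (real s)) / \<kappa>\<^sup>2"
    by simp
  finally show ?thesis
    by simp
qed

text \<open>The coordinates outside \<open>J\<close> above the mean level \<open>T / s\<close>, where \<open>T\<close> is the \<open>\<ell>\<^sub>1\<close>-norm off
  \<open>J\<close>, number at most \<open>s\<close>; adjoining them to \<open>J\<close> replaces the usual choice of the \<open>s\<close> largest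
  coordinates and needs no sorting.\<close>

lemma cone_exists_dominating_set:
  fixes v :: "real ^ 'p"
  assumes s: "1 \<le> s" and J: "card J \<le> s"
    and cone: "lq_norm 1 (restr (- J) v) \<le> lq_norm 1 (restr J v)"
  obtains K where "J \<subseteq> K" "card K \<le> 2 * s" "(norm v)\<^sup>2 \<le> 2 * (norm (restr K v))\<^sup>2"
proof -
  define T where "T = lq_norm 1 (restr (- J) v)"
  define L where "L = {i \<in> - J. T / real s < \<bar>v $ i\<bar>}"
  define K where "K = J \<union> L"
  have T: "0 \<le> T"
    unfolding T_def by (rule lq_norm_1_nonneg)
  have JK: "J \<subseteq> K"
    by (simp add: K_def)
  have "card L \<le> s"
  proof (cases "L = {}")
    case False
    have "real (card L) * (T / real s) = (\<Sum>i\<in>L. T / real s)"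
      by simp
    also have "\<dots> < (\<Sum>i\<in>L. \<bar>v $ i\<bar>)"
      using False by (intro sum_strict_mono) (auto simp: L_def)
    also have "\<dots> \<le> T"
      unfolding T_def lq_norm_1_restr by (intro sum_mono2) (auto simp: L_def)
    \<comment> \<open>For \<open>T = 0\<close> this reads \<open>0 < 0\<close>, so \<open>T\<close>
      is positive and cancels.\<close>
    finally have "real (card L) * T < real s * T"
      using s by (simp add: field_simps)
    then show ?thesis
      using T by (simp add: mult_less_cancel_right)
  qed simp
  then have card_K: "card K \<le> 2 * s"
    using card_Un_le[of J L] J by (simp add: K_def)
  \<comment> \<open>Off \<open>K\<close> each coordinate is at most \<open>T / s\<close>, so the
    squares sum to at most \<open>T^2 / s\<close>; the cone and Cauchy-Schwarz on \<open>J\<close>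
    bound this by the squared norm on \<open>J\<close>.\<close>
  have "(\<Sum>i\<in>- K. (v $ i)\<^sup>2) \<le> (\<Sum>i\<in>- K. (T / real s) * \<bar>v $ i\<bar>)"
  proof (intro sum_mono)
    fix i assume "i \<in> - K"
    then have "\<bar>v $ i\<bar> * \<bar>v $ i\<bar> \<le> (T / real s) * \<bar>v $ i\<bar>"
      by (intro mult_right_mono) (auto simp: K_def L_def)
    then show "(v $ i)\<^sup>2 \<le> (T / real s) * \<bar>v $ i\<bar>"
      by (simp add: power2_eq_square)
  qed
  also have "\<dots> = (T / real s) * (\<Sum>i\<in>- K. \<bar>v $ i\<bar>)"
    by (simp add: sum_distrib_left)
  also have "\<dots> \<le> (T / real s) * T"
    unfolding T_def lq_norm_1_restr
    by (intro mult_left_mono sum_mono2) (use T in \<open>auto simp: K_def sum_nonneg\<close>)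
  also have "\<dots> \<le> (norm (restr J v))\<^sup>2"
  proof -
    have "T \<le> sqrt (real s) * norm (restr J v)"
      using cone lq_norm_1_restr_le[OF J, of v] by (simp add: T_def)
    then have "T\<^sup>2 \<le> (sqrt (real s) * norm (restr J v))\<^sup>2"
      using T by (rule power_mono)
    then show ?thesis
      using s by (simp add: power_mult_distrib field_simps power2_eq_square[of T])
  qed
  also have "\<dots> \<le> (norm (restr K v))\<^sup>2"
    using norm_restr_mono[OF JK] by (simp add: power_mono)
  finally have "(\<Sum>i\<in>- K. (v $ i)\<^sup>2) \<le> (norm (restr K v))\<^sup>2" .
  moreover have "(norm v)\<^sup>2 = (\<Sum>i\<in>K. (v $ i)\<^sup>2) + (\<Sum>i\<in>- K. (v $ i)\<^sup>2)"
    by (simp add: sum_UNIV_split[symmetric] norm_vec_power2)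
  ultimately have "(norm v)\<^sup>2 \<le> 2 * (norm (restr K v))\<^sup>2"
    by (simp add: norm_restr_power2)
  with JK card_K show ?thesis
    by (rule that)
qed

text \<open>The eigenvalue condition is applied on a \<open>K\<close> of at most
  \<open>2 * s\<close> coordinates that carries at least half of the squared norm of
  \<open>v\<close>.\<close>

lemma RE_norm_bound:
  fixes X :: "real ^ 'p ^ 'n"
  assumes RE: "RE X (2 * s) \<kappa>" and s: "1 \<le> s" and J: "card J \<le> s"
    and cone: "lq_norm 1 (restr (- J) v) \<le> lq_norm 1 (restr J v)"
    and gram: "\<And>i. \<bar>(gram X *v v) $ i\<bar> \<le> \<nu>"
  shows "(norm v)\<^sup>2 \<le> (4 * \<nu> / \<kappa>\<^sup>2)\<^sup>2 * real s"
proof -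
  obtain K where K: "J \<subseteq> K" "card K \<le> 2 * s" "(norm v)\<^sup>2 \<le> 2 * (norm (restr K v))\<^sup>2"
    using cone_exists_dominating_set[OF s J cone] .
  have "(norm (restr K v))\<^sup>2 \<le> (2 * \<nu> * sqrt (real s) / \<kappa>\<^sup>2)\<^sup>2"
    using RE_error_bounds(2)[OF RE K(1) J K(2) cone gram] by (simp add: power_mono)
  also have "\<dots> = (4 * \<nu> / \<kappa>\<^sup>2)\<^sup>2 * real s / 4"
    by (simp add: power_mult_distrib power_divide)
  \<comment> \<open>Doubling gives \<open>8 \<nu>^2 s / \<kappa>^4\<close>, half of the constant
    claimed.\<close>
  finally have "2 * (norm (restr K v))\<^sup>2 \<le> (4 * \<nu> / \<kappa>\<^sup>2)\<^sup>2 * real s / 2"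
    by simp
  also have "\<dots> \<le> (4 * \<nu> / \<kappa>\<^sup>2)\<^sup>2 * real s"
    by simp
  finally show ?thesis
    using K(3) by linarith
qed

section \<open>Interpolation between l1 and l2\<close>

text \<open>Weighted AM-GM for \<open>t^q = t^(2-q) * (t^2)^(q-1)\<close>, obtained from convexity
  of \<open>exp\<close> at \<open>ln t\<close> and \<open>2 * ln t\<close>.\<close>

lemma powr_le_linear_plus_square:
  fixes t q :: real
  assumes "0 \<le> t" and "1 < q" and "q \<le> 2"
  shows "t powr q \<le> (2 - q) * t + (q - 1) * t\<^sup>2"
proof (cases "t = 0")
  case False
  then have t: "0 < t"
    using assms by simp
  have "exp ((2 - q) * ln t + (q - 1) * (2 * ln t)) \<le> (2 - q) * exp (ln t) + (q - 1) * exp (2 * ln t)"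
    using convex_onD[OF exp_convex, of "q - 1" "ln t" "2 * ln t"] assms by simp
  moreover have "(2 - q) * ln t + (q - 1) * (2 * ln t) = q * ln t"
    by (simp add: algebra_simps)
  moreover have "exp (2 * ln t) = t\<^sup>2"
    using t by (simp add: exp_double)
  ultimately show ?thesis
    using t by (simp add: powr_def)
qed simp

text \<open>After scaling by \<open>a\<close>, the coordinatewise inequality above stands in for Hoelder's inequality.\<close>

lemma lq_norm_powr_interpolation:
  fixes v :: "real ^ 'p"
  assumes a: "0 \<le> a" and l1: "lq_norm 1 v \<le> a * b" and l2: "(norm v)\<^sup>2 \<le> a\<^sup>2 * b"
    and q: "1 < q" "q \<le> 2"
  shows "lq_norm q v powr q \<le> a powr q * b"
proof -
  have lq: "lq_norm q v powr q = (\<Sum>i\<in>UNIV. \<bar>v $ i\<bar> powr q)"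
    using q by (simp add: lq_norm_def powr_powr sum_nonneg)
  show ?thesis
  proof (cases "a = 0")
    case True
    then have "v = 0"
      using l2 by simp
    then show ?thesis
      unfolding lq using True q by simp
  next
    case False
    then have a: "0 < a"
      using a by simp
    have "\<bar>v $ i\<bar> powr q \<le> a powr q * ((2 - q) * (\<bar>v $ i\<bar> / a) + (q - 1) * ((v $ i)\<^sup>2 / a\<^sup>2))" for i
    proof -
      have "\<bar>v $ i\<bar> powr q = a powr q * (\<bar>v $ i\<bar> / a) powr q"
        using a by (simp add: powr_divide)
      also have "\<dots> \<le> a powr q * ((2 - q) * (\<bar>v $ i\<bar> / a) + (q - 1) * (\<bar>v $ i\<bar> / a)\<^sup>2)"
        using a q by (intro mult_left_mono powr_le_linear_plus_square) auto
      finally show ?thesis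
        by (simp add: power_divide)
    qed
    then have "lq_norm q v powr q
        \<le> (\<Sum>i\<in>UNIV. a powr q * ((2 - q) * (\<bar>v $ i\<bar> / a) + (q - 1) * ((v $ i)\<^sup>2 / a\<^sup>2)))"
      unfolding lq by (intro sum_mono)
    also have "\<dots> = a powr q * ((2 - q) * (lq_norm 1 v / a) + (q - 1) * ((norm v)\<^sup>2 / a\<^sup>2))"
      by (simp add: lq_norm_1 norm_vec_power2 sum.distrib
          sum_distrib_left[symmetric] sum_divide_distrib[symmetric])
    \<comment> \<open>Both normalised norms are at most \<open>b\<close>, and the weights
      \<open>2 - q\<close> and \<open>q - 1\<close> sum to 1.\<close>
    also have "\<dots> \<le> a powr q * ((2 - q) * b + (q - 1) * b)"
      using a q l1 l2 by (intro mult_left_mono add_mono) (auto simp: field_simps)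
    finally show ?thesis
      by (simp add: algebra_simps)
  qed
qed

section \<open>Coherent designs\<close>

text \<open>Diagonal dominance: coordinate \<open>i\<close> of \<open>gram X *v v\<close> is
  \<open>v $ i\<close> plus off-diagonal terms of size at most \<open>\<rho> |v|_1\<close>. The cone
  gives \<open>|v|_1 \<le> 2 s |v|_\<infinity>\<close>, and
  \<open>2 s \<rho> = 2 / (3 \<alpha>)\<close> for the extreme value
  \<open>\<rho> = 1 / (3 \<alpha> s)\<close>.\<close>

lemma coherence_error_bound:
  fixes X :: "real ^ 'p ^ 'n"
  assumes s: "1 \<le> s" and \<alpha>: "1 < \<alpha>"
    and diag: "\<And>i. gram X $ i $ i = 1"
    and off: "\<And>i j. i \<noteq> j \<Longrightarrow> \<bar>gram X $ i $ j\<bar> \<le> 1 / (3 * \<alpha> * real s)"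
    and J: "card J \<le> s" and cone: "lq_norm 1 (restr (- J) v) \<le> lq_norm 1 (restr J v)"
    and gram: "\<And>i. \<bar>(gram X *v v) $ i\<bar> \<le> \<nu>"
  shows "infnorm v \<le> 3 * \<alpha> / (3 * \<alpha> - 2) * \<nu>"
proof -
  define \<rho> where "\<rho> = 1 / (3 * \<alpha> * real s)"
  have \<rho>: "0 \<le> \<rho>"
    using \<alpha> by (simp add: \<rho>_def)
  have "lq_norm 1 (restr J v) \<le> (\<Sum>i\<in>J. infnorm v)"
    unfolding lq_norm_1_restr by (intro sum_mono component_le_infnorm_cart)
  also have "\<dots> \<le> real s * infnorm v"
    using J by (simp add: mult_right_mono infnorm_pos_le)
  finally have "lq_norm 1 v \<le> 2 * (real s * infnorm v)"
    using cone lq_norm_1_split[of v J] by linarith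
  then have "\<rho> * lq_norm 1 v \<le> \<rho> * (2 * (real s * infnorm v))"
    using \<rho> by (rule mult_left_mono)
  also have "\<dots> = 2 / (3 * \<alpha>) * infnorm v"
    using s by (simp add: \<rho>_def)
  finally have l1: "\<rho> * lq_norm 1 v \<le> 2 / (3 * \<alpha>) * infnorm v" .
  have "\<bar>v $ i\<bar> \<le> \<nu> + 2 / (3 * \<alpha>) * infnorm v" for i
  proof -
    have "(gram X *v v) $ i = v $ i + (\<Sum>j\<in>UNIV - {i}. gram X $ i $ j * v $ j)"
      using diag by (simp add: matrix_vector_mult_def sum.remove[of UNIV i])
    moreover have "\<bar>\<Sum>j\<in>UNIV - {i}. gram X $ i $ j * v $ j\<bar> \<le> \<rho> * lq_norm 1 v"
    proof -
      have "\<bar>\<Sum>j\<in>UNIV - {i}. gram X $ i $ j * v $ j\<bar> \<le> (\<Sum>j\<in>UNIV - {i}. \<rho> * \<bar>v $ j\<bar>)"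
        using off unfolding \<rho>_def[symmetric]
        by (intro order_trans[OF sum_abs] sum_mono) (auto simp: abs_mult intro!: mult_right_mono)
      also have "\<dots> \<le> (\<Sum>j\<in>UNIV. \<rho> * \<bar>v $ j\<bar>)"
        using \<rho> by (intro sum_mono2) auto
      finally show ?thesis
        by (simp add: lq_norm_1 sum_distrib_left)
    qed
    ultimately show ?thesis
      using gram[of i] l1 by linarith
  qed
  then have "infnorm v \<le> \<nu> + 2 / (3 * \<alpha>) * infnorm v"
    by (simp add: infnorm_vec_le_iff)
  \<comment> \<open>Since \<open>\<alpha> > 1\<close>, the factor
    \<open>1 - 2 / (3 \<alpha>)\<close> is positive and the sup norm term can be absorbed on the
    left.\<close>
  then show ?thesis
    using \<alpha> by (simp add: field_simps)
qed

section \<open>Effect of the design perturbation\<close>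

text \<open>Columns of \<open>X\<close> have length \<open>sqrt n\<close> and those of
  \<open>\<Xi>\<close> at most \<open>\<delta> sqrt n\<close>, hence those of \<open>Z\<close> at
  most \<open>(1 + \<delta>) sqrt n\<close>. These are the terms that arise when \<open>X\<close> is
  traded for \<open>Z\<close>.\<close>

lemma perturbed_design_bounds:
  fixes X \<Xi> Z :: "real ^ 'p ^ 'n"
  assumes "0 \<le> \<delta>" and Z: "Z = X + \<Xi>" and "\<And>i. gram X $ i $ i = 1" and \<Xi>: "infnorm \<Xi> \<le> \<delta>"
  shows "\<bar>((1 / real CARD('n)) *\<^sub>R (transpose Z *v (\<Xi> *v u))) $ i\<bar> \<le> (1 + \<delta>) * \<delta> * lq_norm 1 u"
    and "\<bar>((1 / real CARD('n)) *\<^sub>R (transpose \<Xi> *v (X *v u))) $ i\<bar> \<le> \<delta> * lq_norm 1 u"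
proof -
  have X_col: "norm (column j X) \<le> sqrt (real CARD('n))" for j
    using assms by (simp add: norm_column_eq)
  have \<Xi>_col: "norm (column j \<Xi>) \<le> sqrt (real CARD('n)) * \<delta>" for j
    using \<Xi> by (intro norm_le_sqrt_card_times_bound) (simp add: infnorm_mat_le_iff column_def)
  have "column i Z = column i X + column i \<Xi>"
    by (simp add: Z column_def vec_eq_iff)
  then have "norm (column i Z) \<le> sqrt (real CARD('n)) * (1 + \<delta>)"
    using norm_triangle_ineq[of "column i X" "column i \<Xi>"] X_col[of i] \<Xi>_col[of i]
    by (simp add: distrib_left)
  moreover have "norm (\<Xi> *v u) \<le> sqrt (real CARD('n)) * (\<delta> * lq_norm 1 u)"
    using norm_mult_vec_le[OF \<Xi>_col, of u] by (simp add: mult.assoc)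
  ultimately show "\<bar>((1 / real CARD('n)) *\<^sub>R (transpose Z *v (\<Xi> *v u))) $ i\<bar> \<le> (1 + \<delta>) * \<delta> * lq_norm 1 u"
    using abs_transpose_mult_component_le[of i Z "1 + \<delta>" "\<Xi> *v u" "\<delta> * lq_norm 1 u"]
    by (simp add: mult.assoc)
  have "norm (X *v u) \<le> sqrt (real CARD('n)) * lq_norm 1 u"
    by (rule norm_mult_vec_le[OF X_col])
  then show "\<bar>((1 / real CARD('n)) *\<^sub>R (transpose \<Xi> *v (X *v u))) $ i\<bar> \<le> \<delta> * lq_norm 1 u"
    by (rule abs_transpose_mult_component_le[OF \<Xi>_col])
qed

section \<open>Combination of the estimates\<close>

theorem theorem3:
  fixes X \<Xi> Z :: "real ^ 'p ^ 'n"
    and \<xi> y :: "real ^ 'n"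
    and \<theta>\<^sub>s \<theta>hat :: "real ^ 'p"
    and \<Theta> :: "(real ^ 'p) set"
    and s :: nat
    and \<delta> \<epsilon> \<nu> :: real
  assumes "1 \<le> s" and "s \<le> CARD('p)"
    and "0 \<le> \<delta>" and "0 \<le> \<epsilon>"
    and "convex \<Theta>"
    and "\<theta>\<^sub>s \<in> \<Theta>" and "s_sparse s \<theta>\<^sub>s"
    and "y = X *v \<theta>\<^sub>s + \<xi>" and "Z = X + \<Xi>"
    and "\<forall>i. gram X $ i $ i = 1"
    and "infnorm ((1 / real CARD('n)) *\<^sub>R (transpose Z *v \<xi>)) \<le> \<epsilon>"
    and "infnorm \<Xi> \<le> \<delta>"
    and "\<nu> = 2 * (2 + \<delta>) * \<delta> * lq_norm 1 \<theta>\<^sub>s + 2 * \<epsilon>"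
    and "is_arg_min (lq_norm 1) (feasible \<Theta> Z y \<delta> \<epsilon>) \<theta>hat"
  shows
    "(\<forall>\<kappa>. RE X s \<kappa> \<longrightarrow>
        lq_norm 1 (\<theta>hat - \<theta>\<^sub>s) \<le> 4 * \<nu> * real s / \<kappa>\<^sup>2 \<and>
        1 / real CARD('n) * (norm (X *v (\<theta>hat - \<theta>\<^sub>s)))\<^sup>2 \<le> 4 * \<nu>\<^sup>2 * real s / \<kappa>\<^sup>2) \<and>
     (\<forall>\<kappa>. RE X (2 * s) \<kappa> \<longrightarrow>
        (\<forall>q. 1 < q \<and> q \<le> 2 \<longrightarrow>
           lq_norm q (\<theta>hat - \<theta>\<^sub>s) powr q \<le> (4 * \<nu> / \<kappa>\<^sup>2) powr q * real s)) \<and>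
     (\<forall>\<rho> \<alpha>. \<alpha> > 1 \<and> \<rho> < 1 / (3 * \<alpha> * real s) \<and> coherence X \<rho> \<longrightarrow>
        infnorm (\<theta>hat - \<theta>\<^sub>s) \<le> (3 * \<alpha> + 1) / (3 * (\<alpha> - 1)) * \<nu> \<and>
        (\<nu> > 0 \<longrightarrow> infnorm (\<theta>hat - \<theta>\<^sub>s) < (3 * \<alpha> + 1) / (3 * (\<alpha> - 1)) * \<nu>))"
proof -
  define v where "v = \<theta>hat - \<theta>\<^sub>s"
  define c where "c = 1 / real CARD('n)"
  define J where "J = {i. \<theta>\<^sub>s $ i \<noteq> 0}"
  have diag: "gram X $ i $ i = 1" for i
    using assms(10) by simp
  note pert = perturbed_design_bounds[OF assms(3) assms(9) diag assms(12), folded c_def]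
  have noise: "\<bar>(c *\<^sub>R (transpose Z *v \<xi>)) $ i\<bar> \<le> \<epsilon>" for i
    using assms(11) by (simp add: infnorm_vec_le_iff c_def)
  have feas: "feasible \<Theta> Z y \<delta> \<epsilon> \<theta>\<^sub>s"
  proof -
    \<comment> \<open>The \<open>X\<close> parts cancel; the bounds for the remaining noise and
      perturbation terms add up exactly to the constraint level.\<close>
    have "y - Z *v \<theta>\<^sub>s = \<xi> - \<Xi> *v \<theta>\<^sub>s"
      by (simp add: assms(8,9) matrix_vector_mult_add_rdistrib)
    then have "c *\<^sub>R (transpose Z *v (y - Z *v \<theta>\<^sub>s))
        = c *\<^sub>R (transpose Z *v \<xi>) - c *\<^sub>R (transpose Z *v (\<Xi> *v \<theta>\<^sub>s))"
      by (simp add: matrix_vector_mult_diff_distrib scaleR_diff_right)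
    then have "\<bar>(c *\<^sub>R (transpose Z *v (y - Z *v \<theta>\<^sub>s))) $ i\<bar>
        \<le> (1 + \<delta>) * \<delta> * lq_norm 1 \<theta>\<^sub>s + \<epsilon>" for i
      using noise[of i] pert(1)[of \<theta>\<^sub>s i] by simp
    then show ?thesis
      using assms(6) by (simp add: feasible_def infnorm_vec_le_iff c_def)
  qed
  have feas_hat: "feasible \<Theta> Z y \<delta> \<epsilon> \<theta>hat" and min: "lq_norm 1 \<theta>hat \<le> lq_norm 1 \<theta>\<^sub>s"
    using assms(14) feas by (auto simp: is_arg_min_def not_less)
  have J: "card J \<le> s"
    using assms(7) by (simp add: s_sparse_def J_def)
  have cone: "lq_norm 1 (restr (- J) v) \<le> lq_norm 1 (restr J v)"
    unfolding v_def by (rule cone_of_lq_norm_1_le[OF min]) (simp add: J_def)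
  have gram: "\<bar>(gram X *v v) $ i\<bar> \<le> \<nu>" for i
  proof -
    define r where "r = y - Z *v \<theta>hat"
    \<comment> \<open>\<open>X v\<close> is expressed through the residual \<open>r\<close>, which
      feasibility controls once \<open>Z\<close> transposed is applied; returning to
      \<open>X\<close> transposed costs the extra \<open>\<Xi>\<close> term.\<close>
    have "X *v v = \<xi> - r - \<Xi> *v \<theta>hat"
      by (simp add: r_def v_def assms(8,9) matrix_vector_mult_add_rdistrib
          matrix_vector_mult_diff_distrib)
    then have "transpose Z *v (X *v v)
        = transpose Z *v \<xi> - transpose Z *v r - transpose Z *v (\<Xi> *v \<theta>hat)"
      by (simp add: matrix_vector_mult_diff_distrib)
    moreover have "transpose Z = transpose X + transpose \<Xi>"
      by (simp add: assms(9) transpose_def vec_eq_iff)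
    ultimately have "transpose X *v (X *v v) = transpose Z *v \<xi> - transpose Z *v r
        - transpose Z *v (\<Xi> *v \<theta>hat) - transpose \<Xi> *v (X *v v)"
      by (simp add: matrix_vector_mult_add_rdistrib algebra_simps)
    then have "gram X *v v = c *\<^sub>R (transpose Z *v \<xi>) - c *\<^sub>R (transpose Z *v r)
        - c *\<^sub>R (transpose Z *v (\<Xi> *v \<theta>hat)) - c *\<^sub>R (transpose \<Xi> *v (X *v v))"
      by (simp add: gram_mult c_def scaleR_diff_right)
    moreover have "\<bar>(c *\<^sub>R (transpose Z *v r)) $ i\<bar> \<le> (1 + \<delta>) * \<delta> * lq_norm 1 \<theta>hat + \<epsilon>"
      using feas_hat by (simp add: feasible_def infnorm_vec_le_iff c_def r_def)
    \<comment> \<open>Noise and constraint contribute \<open>\<epsilon>\<close> each; the constraint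
      and the term \<open>\<Xi> *v \<theta>hat\<close> contribute
      \<open>(1 + \<delta>) \<delta> |\<theta>hat|_1\<close> each.\<close>
    ultimately have "\<bar>(gram X *v v) $ i\<bar>
        \<le> 2 * \<epsilon> + 2 * ((1 + \<delta>) * \<delta> * lq_norm 1 \<theta>hat) + \<delta> * lq_norm 1 v"
      using noise[of i] pert(1)[of \<theta>hat i] pert(2)[of v i] by simp
    moreover have "(1 + \<delta>) * \<delta> * lq_norm 1 \<theta>hat \<le> (1 + \<delta>) * \<delta> * lq_norm 1 \<theta>\<^sub>s"
      using min assms(3) by (intro mult_left_mono) auto
    moreover have "\<delta> * lq_norm 1 v \<le> \<delta> * (2 * lq_norm 1 \<theta>\<^sub>s)"
      using min assms(3) lq_norm_1_triangle_diff[of \<theta>hat \<theta>\<^sub>s]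
      by (intro mult_left_mono) (auto simp: v_def)
    \<comment> \<open>The coefficients add up as \<open>2 (1 + \<delta>) \<delta> + 2 \<delta> = 2
      (2 + \<delta>) \<delta>\<close>, which is the one in \<open>\<nu>\<close>.\<close>
    ultimately show ?thesis
      by (simp add: assms(13) algebra_simps)
  qed
  have \<nu>: "0 \<le> \<nu>"
    using gram[of undefined] by linarith
  show ?thesis
    unfolding v_def[symmetric]
  proof (intro conjI allI impI; (elim conjE)?)
    fix \<kappa> assume RE: "RE X s \<kappa>"
    show "lq_norm 1 v \<le> 4 * \<nu> * real s / \<kappa>\<^sup>2"
      by (rule RE_lq_norm_1_bound[OF RE order_refl J cone gram])
    have "(norm (X *v v) / sqrt (real CARD('n)))\<^sup>2 \<le> (2 * \<nu> * sqrt (real s) / \<kappa>)\<^sup>2"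
      using RE_error_bounds(1)[OF RE order_refl J J cone gram] by (simp add: power_mono)
    then show "1 / real CARD('n) * (norm (X *v v))\<^sup>2 \<le> 4 * \<nu>\<^sup>2 * real s / \<kappa>\<^sup>2"
      by (simp add: power_divide power_mult_distrib)
  next
    fix \<kappa> q :: real assume RE: "RE X (2 * s) \<kappa>" and q: "1 < q" "q \<le> 2"
    \<comment> \<open>Interpolation is used with \<open>a = 4 \<nu> / \<kappa>^2\<close> and
      \<open>b = s\<close>, for which the l1 and l2 bounds have the required shapes
      \<open>a b\<close> and \<open>a^2 b\<close>.\<close>
    have "lq_norm 1 v \<le> 4 * \<nu> / \<kappa>\<^sup>2 * real s"
      using RE_lq_norm_1_bound[OF RE _ J cone gram] by simp
    then show "lq_norm q v powr q \<le> (4 * \<nu> / \<kappa>\<^sup>2) powr q * real s"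
      using \<nu> RE_norm_bound[OF RE assms(1) J cone gram] q
      by (intro lq_norm_powr_interpolation) auto
  next
    fix \<rho> \<alpha> :: real
    assume \<alpha>: "1 < \<alpha>" and \<rho>: "\<rho> < 1 / (3 * \<alpha> * real s)" and coh: "coherence X \<rho>"
    have "\<bar>gram X $ i $ j\<bar> \<le> 1 / (3 * \<alpha> * real s)" if "i \<noteq> j" for i j
      using coh \<rho> that unfolding coherence_def by (meson less_imp_le order_trans)
    then have inf: "infnorm v \<le> 3 * \<alpha> / (3 * \<alpha> - 2) * \<nu>"
      by (rule coherence_error_bound[OF assms(1) \<alpha> diag _ J cone gram])
    \<comment> \<open>Cross-multiplying, the difference of the two sides is
      \<open>6 \<alpha> - 2 > 0\<close>.\<close>
    have const: "3 * \<alpha> / (3 * \<alpha> - 2) < (3 * \<alpha> + 1) / (3 * (\<alpha> - 1))"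
      using \<alpha> by (simp add: field_simps)
    show "infnorm v \<le> (3 * \<alpha> + 1) / (3 * (\<alpha> - 1)) * \<nu>"
      using inf mult_right_mono[OF less_imp_le[OF const] \<nu>] by linarith
    \<comment> \<open>Strictness comes from the gap between the two constants times
      \<open>\<nu> > 0\<close>; for \<open>\<nu> = 0\<close> both sides are 0.\<close>
    show "infnorm v < (3 * \<alpha> + 1) / (3 * (\<alpha> - 1)) * \<nu>" if "0 < \<nu>"
      using inf mult_strict_right_mono[OF const that] by linarith
  qed
qed

end
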